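(* 1. For every $p\in[1,\infty)$, $$R_{\min}^{\mathrm{CN}}(p)=\min\left\{\frac12,\ \frac{2}{1+2^{2-\frac1p}}\right\},$$ and $R_{\min}^{\mathrm{CN}}(\infty)=2/5$. 2. For $p\in[1,\infty)$, let $R(p)$ denote the unique solution $R\in[0,1]$ of the equation $$(2-R)^p+(3-3R)^p=(4R)^p .$$ Then for every $p\in[1,\infty)$, $R_{\min}^{\mathrm{NN}}(p)=\min\left\{\frac12,\ R(p)\right\}$, and $R_{\min}^{\mathrm{NN}}(\infty)=3/7$.
   Context: Norms: for $Q=(x,y)\in\mathbb{R}^2$, $\|Q\|_p=(|x|^p+|y|^p)^{1/p}$ if $p\in[1,\infty)$ and $\|Q\|_\infty=\max\{|x|,|y|\}$. Point collections: $\mathcal{P}=\prod_{(i,j)\in\mathbb{Z}^2}[i,i+1]\times[j,j+1]$. An element is a family $P=(P_{i,j})_{(i,j)\in\mathbb{Z}^2}$ with $P_{i,j}\in[i,i+1]\times[j,j+1]$. Complete neighbor model: for $P\in\mathcal{P}$ and $R>0$, $\Gamma_{p,R}^{\mathrm{CN}}(P)$ is the undirected graph with vertex set $\mathbb{Z}^2$ and edge set $E_{p,R}^{\mathrm{CN}}(P)=\{(u,v)\in\mathbb{Z}^2\times\mathbb{Z}^2: u\neq v,\ \|P_u-P_v\|_p\le R\}$. Nearest neighbor model: $\Gamma_{p,R}^{\mathrm{NN}}(P)$ is the undirected graph with vertex set $\mathbb{Z}^2$ and edge set $E_{p,R}^{\mathrm{NN}}(P)=E_{p,R}^{\mathrm{CN}}(P)\cap\{(u,v):\|u-v\|_1=1\}$.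 For a graph $G$ on $\mathbb{Z}^2$, $\mathcal{C}_0(G)$ is the connected component of $(0,0)$, i.e. the set of vertices connected to $(0,0)$ by a finite path of $G$. Possible connectivity radius: for $\ast\in\{\mathrm{CN},\mathrm{NN}\}$, $R_{\min}^{\ast}(p)=\inf\{R>0:\ \exists P\in\mathcal{P},\ |\mathcal{C}_0(\Gamma_{p,R}^{\ast}(P))|=\infty\}$. *)

theory Defs
  imports Complex_Main "HOL-Library.Extended_Real" "HOL-Library.Product_Plus"
begin

(* Only exponents p with 1 <= p <= \<infinity> are meaningful.  Note 0 powr p = 0, as needed. *)
definition pnorm :: "ereal \<Rightarrow> real \<times> real \<Rightarrow> real" where
  "pnorm p Q =
     (if p = \<infinity> then max \<bar>fst Q\<bar> \<bar>snd Q\<bar>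
      else (\<bar>fst Q\<bar> powr real_of_ereal p + \<bar>snd Q\<bar> powr real_of_ereal p)
             powr (1 / real_of_ereal p))"

definition point_collections :: "(int \<times> int \<Rightarrow> real \<times> real) set" where
  "point_collections =
     {P. \<forall>i j. P (i, j) \<in> {real_of_int i .. real_of_int i + 1} \<times> {real_of_int j .. real_of_int j + 1}}"

(* Graphs on the full vertex set \<int> \<times> \<int>, represented by their (symmetric) edge relations. *)
definition edges_CN ::
  "ereal \<Rightarrow> real \<Rightarrow> (int \<times> int \<Rightarrow> real \<times> real) \<Rightarrow> (int \<times> int) rel" where
  "edges_CN p R P = {(u, v). u \<noteq> v \<and> pnorm p (P u - P v) \<le> R}"

definition edges_NN ::
  "ereal \<Rightarrow> real \<Rightarrow> (int \<times> int \<Rightarrow> real \<times> real) \<Rightarrow> (int \<times> int) rel" where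
  "edges_NN p R P =
     edges_CN p R P \<inter> {(u, v). pnorm 1 (map_prod real_of_int real_of_int (u - v)) = 1}"

definition component0 :: "(int \<times> int) rel \<Rightarrow> (int \<times> int) set" where
  "component0 E = {v. ((0, 0), v) \<in> E\<^sup>*}"

(* The sets below are nonempty (every large R belongs to them) and bounded below by 0,
   so the real-valued Inf is the genuine infimum. *)
definition Rmin_CN :: "ereal \<Rightarrow> real" where
  "Rmin_CN p = Inf {R. R > 0 \<and> (\<exists>P \<in> point_collections. infinite (component0 (edges_CN p R P)))}"

definition Rmin_NN :: "ereal \<Rightarrow> real" where
  "Rmin_NN p = Inf {R. R > 0 \<and> (\<exists>P \<in> point_collections. infinite (component0 (edges_NN p R P)))}"

definition is_critical_root :: "real \<Rightarrow> real \<Rightarrow> bool" where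
  "is_critical_root p R \<longleftrightarrow>
     R \<in> {0..1} \<and> (2 - R) powr p + (3 - 3 * R) powr p = (4 * R) powr p"

definition critical_root :: "real \<Rightarrow> real" where
  "critical_root p = (THE R. is_critical_root p R)"

end

theory Submission
  imports Defs
begin

text \<open>
  Lower bounds. For \<open>R < 1/2\<close> any three consecutive cells of a path lie in a common \<open>2 \<times> 2\<close> block,
  and the centre of that block moves alternately horizontally and vertically by one unit or
  rests; it rests exactly when four consecutive cells fill a block. Between two consecutive
  rests in the same direction, \<open>2K\<close> cells apart, the path advances by at least \<open>K - 1\<close> in that
  direction, using \<open>2K - 1\<close> steps. If a horizontal and a vertical stretch with \<open>K \<ge> 3\<close> overlap,
  they share exactly two steps, so that such stretches form an infinite alternating chain in
  which each stretch must obtain \<open>2 - R\<close> (if \<open>K = 3\<close>) or \<open>3 - 3R\<close> (if \<open>K \<ge> 4\<close>) from its four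
  shared steps. Under the nearest neighbour rule two consecutive stretches with \<open>K = 3\<close> would
  close a cycle of twelve cells. Tangent lines of \<open>t\<^sup>p\<close> convert the bound on the step length
  into linear inequalities, and a potential that decreases at every corner of the chain then
  rules the chain out.

  Upper bounds. Explicit periodic paths: a zigzag along the line between two rows (\<open>R = 1/2\<close>),
  a diagonal path of period \<open>(2,2)\<close> with six cells, and a meandering path of period \<open>(4,0)\<close>
  with sixteen cells.
\<close>

section \<open>Paths of cells\<close>

text \<open>
  \<open>q n\<close> and \<open>r n\<close> are the displacements of the \<open>n\<close>-th stretch at its two ends. Weighting a
  deficit \<open>q n - Dn n / 2\<close> by \<open>\<beta>\<close> for long and by \<open>\<alpha>\<close> for short stretches makes it grow by a
  fixed amount at every corner, forwards or backwards.
\<close>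

lemma no_bounded_weighted_chain:
  fixes q r :: "nat \<Rightarrow> real" and B :: "nat \<Rightarrow> bool"
  assumes \<alpha>: "0 < \<alpha>" "\<alpha> \<le> \<beta>" and D: "D3 \<le> D4"
    and sum: "\<And>n. (if B n then D4 else D3) \<le> q n + r n"
    and B: "\<And>n. B n \<or> B (Suc n)"
    and C1: "\<And>n. \<alpha> * r n + \<beta> * q (Suc n) \<le> C"
    and C2: "\<And>n. \<beta> * r n + \<alpha> * q (Suc n) \<le> C"
    and C: "C < (\<alpha> * D3 + \<beta> * D4) / 2"
    and M: "\<And>n. \<bar>q n\<bar> \<le> M"
  shows False
proof -
  define w where "w n = (if B n then \<beta> else \<alpha>)" for n
  define Dn where "Dn n = (if B n then D4 else D3)" for n
  define e where "e n = w n * (q n - Dn n / 2)" for n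
  define \<delta> where "\<delta> = (\<alpha> * D3 + \<beta> * D4) / 2 - C"
  have \<delta>: "\<delta> > 0" using C by (simp add: \<delta>_def)
  have \<beta>: "\<beta> > 0" using \<alpha> by simp
  \<comment> \<open>Passing from the short weight and demand to the long ones only lowers a
    nonpositive term. This serves the corners between two long stretches, where each corner bound
    carries just one factor \<open>\<beta>\<close>.\<close>
  have scale: "\<beta> * (v - D4 / 2) \<le> \<alpha> * (v - D3 / 2)" if "\<alpha> * (v - D3 / 2) \<le> 0" for v
  proof -
    have "v - D3 / 2 \<le> 0" using that \<alpha>(1) by (simp add: mult_le_0_iff)
    then have "\<beta> * (v - D3 / 2) \<le> \<alpha> * (v - D3 / 2)"
      using \<alpha>(2) by (rule mult_right_mono_neg[rotated])
    moreover have "\<beta> * (v - D4 / 2) \<le> \<beta> * (v - D3 / 2)"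
      using \<beta> D by (intro mult_left_mono) auto
    ultimately show ?thesis by simp
  qed
  \<comment> \<open>One of the two sign conditions eventually holds at every index: once
    \<open>e\<close> is nonpositive it stays so, and otherwise it is positive throughout.\<close>
  have dec: "e (Suc n) \<le> e n - \<delta>" if cond: "e n \<le> 0 \<or> e (Suc n) > 0" for n
  proof -
    define e' where "e' = w n * (r n - Dn n / 2)"
    have "w n > 0" using \<alpha> \<beta> by (simp add: w_def)
    then have "w n * (Dn n - q n) \<le> w n * r n"
      using sum[of n] by (intro mult_left_mono) (auto simp: Dn_def)
    then have ee: "- e n \<le> e'" by (simp add: e_def e'_def algebra_simps)
    have "e' + e (Suc n) \<le> - \<delta>"
    proof (cases "B n \<and> B (Suc n)")
      case False
      then consider "B n" "\<not> B (Suc n)" | "\<not> B n" "B (Suc n)" using B by blast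
      then show ?thesis
        using C1[of n] C2[of n]
        by cases (simp_all add: e_def e'_def w_def Dn_def \<delta>_def field_simps)
    next
      case True
      show ?thesis
      proof (cases "e n \<le> 0")
        case e: True
        have "e' + \<alpha> * (q (Suc n) - D3 / 2) \<le> - \<delta>"
          using True C2[of n] by (simp add: e'_def w_def Dn_def \<delta>_def field_simps)
        with ee e \<delta> scale[of "q (Suc n)"] True show ?thesis
          by (simp add: e_def w_def Dn_def)
      next
        case False
        then have e: "e (Suc n) > 0" using cond by simp
        have "e (Suc n) + \<alpha> * (r n - D3 / 2) \<le> - \<delta>"
          using True C1[of n] by (simp add: e_def w_def Dn_def \<delta>_def field_simps)
        with e \<delta> scale[of "r n"] True show ?thesis
          by (simp add: e'_def w_def Dn_def)
      qed
    qed
    with ee show ?thesis by simp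
  qed
  have bound: "\<bar>e n\<bar> \<le> \<beta> * (M + \<bar>D3\<bar> + \<bar>D4\<bar>)" for n
  proof -
    have "\<bar>e n\<bar> = w n * \<bar>q n - Dn n / 2\<bar>"
      using \<alpha> by (simp add: e_def w_def abs_mult)
    also have "\<dots> \<le> \<beta> * (M + \<bar>D3\<bar> + \<bar>D4\<bar>)"
      using \<alpha> M[of n] by (intro mult_mono) (auto simp: w_def Dn_def)
    finally show ?thesis .
  qed
  have drift: "e (N + n) \<le> e N - real n * \<delta>"
    if "\<forall>n\<ge>N. e (Suc n) \<le> e n - \<delta>" for N n
  proof (induction n)
    case (Suc n)
    then show ?case using that[rule_format, of "N + n"] by (simp add: algebra_simps)
  qed simp
  obtain N where N: "\<forall>n\<ge>N. e (Suc n) \<le> e n - \<delta>"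
  proof (cases "\<exists>N. e N \<le> 0")
    case True
    then obtain N where N: "e N \<le> 0" by blast
    have neg: "e n \<le> 0" if "N \<le> n" for n
      using that
    proof (induction n rule: dec_induct)
      case (step n)
      then show ?case using dec[of n] \<delta> by simp
    qed (rule N)
    show ?thesis by (rule that[of N]) (use dec neg in blast)
  next
    case False
    then show ?thesis using dec that[of 0] by (meson not_le)
  qed
  obtain n where n: "2 * (\<beta> * (M + \<bar>D3\<bar> + \<bar>D4\<bar>)) < real n * \<delta>"
    using reals_Archimedean3[OF \<delta>] by blast
  show False using drift[OF N, of n] bound[of N] bound[of "N + n"] n by linarith
qed

section \<open>Full blocks and the alternation of slots\<close>

text \<open>
  Both coordinates are treated at once: \<open>c d\<close> and \<open>p d\<close> are the first coordinates of the cells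
  and of the points if \<open>d\<close> holds, and the second ones otherwise.
\<close>

locale cell_path =
  fixes c :: "bool \<Rightarrow> nat \<Rightarrow> int" and p :: "bool \<Rightarrow> nat \<Rightarrow> real" and R :: real
  assumes R: "R < 1 / 2"
    and cell: "real_of_int (c d k) \<le> p d k" "p d k \<le> real_of_int (c d k) + 1"
    and step: "\<bar>p d (Suc k) - p d k\<bar> \<le> R"
    and inj: "inj (\<lambda>k. (c True k, c False k))"
begin

lemma displacement: "\<bar>p d (k + n) - p d k\<bar> \<le> real n * R"
proof (induction n)
  case (Suc n)
  then show ?case using step[of d "k + n"] by (simp add: algebra_simps)
qed simp

text \<open>Two steps move a coordinate by less than 1 because \<open>R < 1 / 2\<close>; the integer
  columns then differ by less than 2.\<close>

lemma column_diff:
  assumes "k \<le> l" "l \<le> k + 2"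
  shows "\<bar>c d l - c d k\<bar> \<le> 1"
proof -
  obtain n where n: "l = k + n" "n \<le> 2" using assms by (metis le_add_diff_inverse nat_add_left_cancel_le)
  have "0 \<le> R" using step[of d k] by simp
  have "real n * R \<le> 2 * R" using n(2) \<open>0 \<le> R\<close> by (intro mult_right_mono) auto
  then have "\<bar>p d l - p d k\<bar> < 1" using displacement[of d k n] R n(1) by simp
  then have "real_of_int (c d l) - real_of_int (c d k) < 2" "real_of_int (c d k) - real_of_int (c d l) < 2"
    using cell[of d k] cell[of d l] by linarith+
  then show ?thesis by linarith
qed

lemma column_diffs:
  "\<bar>c d (k + 1) - c d k\<bar> \<le> 1" "\<bar>c d (k + 2) - c d k\<bar> \<le> 1" "\<bar>c d (k + 2) - c d (k + 1)\<bar> \<le> 1"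
  "\<bar>c d (k + 3) - c d (k + 1)\<bar> \<le> 1" "\<bar>c d (k + 3) - c d (k + 2)\<bar> \<le> 1"
  "\<bar>c d (k + 4) - c d (k + 2)\<bar> \<le> 1" "\<bar>c d (k + 4) - c d (k + 3)\<bar> \<le> 1"
  by (auto intro!: column_diff)

lemma distinct: "k \<noteq> l \<Longrightarrow> c d k \<noteq> c d l \<or> c (\<not> d) k \<noteq> c (\<not> d) l"
  using inj by (cases d) (auto simp: inj_def)

text \<open>
  \<open>full k\<close> means that the four cells from \<open>k\<close> on form a \<open>2 \<times> 2\<close> block. The second disjunct of
  \<open>slot d k\<close> tells for which direction \<open>d\<close> this block replaces a shift by two cells; this is
  what makes the directions alternate.
\<close>

definition full :: "nat \<Rightarrow> bool" where
  "full k \<longleftrightarrow> (\<forall>d. \<bar>c d (k + 3) - c d k\<bar> \<le> 1)"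

definition slot :: "bool \<Rightarrow> nat \<Rightarrow> bool" where
  "slot d k \<longleftrightarrow> \<bar>c d (k + 3) - c d k\<bar> > 1 \<or> full k \<and> c (\<not> d) (k + 1) = c (\<not> d) k"

text \<open>Cells at most two steps apart differ by at most 1, so a larger change over three steps
  is exactly 2, with both inner cells in the middle column.\<close>

lemma shift:
  assumes "\<bar>c d (k + 3) - c d k\<bar> > 1"
  obtains \<sigma> where "\<bar>\<sigma>\<bar> = 1" "c d (k + 1) = c d k + \<sigma>" "c d (k + 2) = c d k + \<sigma>" "c d (k + 3) = c d k + 2 * \<sigma>"
proof (rule that[of "c d (k + 1) - c d k"])
qed (use assms column_diffs(1,2,4,5)[of d k] in \<open>smt (verit)\<close>)+

text \<open>Three distinct cells determine the 2 by 2 block containing them. Two successive full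
  blocks would coincide and hold five distinct cells.\<close>

lemma full_Suc: "full k \<Longrightarrow> \<not> full (k + 1)"
proof
  assume "full k" "full (k + 1)"
  then have f: "\<bar>c d (k + 3) - c d k\<bar> \<le> 1" "\<bar>c d (k + 4) - c d (k + 1)\<bar> \<le> 1" for d
    by (auto simp: full_def add.commute[of _ 3] add.commute[of _ 4])
  note facts = column_diffs[of True k] column_diffs[of False k] f[of True] f[of False]
    distinct[of "k" "k + 1" True] distinct[of "k" "k + 2" True] distinct[of "k" "k + 3" True]
    distinct[of "k" "k + 4" True] distinct[of "k + 1" "k + 2" True] distinct[of "k + 1" "k + 3" True]
    distinct[of "k + 1" "k + 4" True] distinct[of "k + 2" "k + 3" True] distinct[of "k + 2" "k + 4" True]
    distinct[of "k + 3" "k + 4" True]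
  show False using facts by simp (smt (verit))
qed

lemma slot_Suc:
  assumes "slot d k"
  shows "slot (\<not> d) (k + 1)"
proof -
  \<comment> \<open>A shift in direction \<open>d\<close> from \<open>k + 1\<close> has its inner
    cells \<open>k + 2\<close> and \<open>k + 3\<close> in one column, so the shift must be in the
    other direction.\<close>
  have *: "\<bar>c (\<not> d) (k + 4) - c (\<not> d) (k + 1)\<bar> > 1"
    if "\<not> full (k + 1)" "c d (k + 2) \<noteq> c d (k + 3)"
  proof (rule ccontr)
    assume "\<not> ?thesis"
    with that(1) have "\<bar>c d (k + 1 + 3) - c d (k + 1)\<bar> > 1"
      unfolding full_def by (smt (verit) add.assoc numeral_plus_one semiring_norm)
    then show False using that(2) by - (erule shift, auto simp: numeral_eq_Suc)
  qed
  show ?thesis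
  proof (cases "\<bar>c d (k + 3) - c d k\<bar> > 1")
    case True
    then obtain \<sigma> where \<sigma>: "\<bar>\<sigma>\<bar> = 1" "c d (k + 1) = c d k + \<sigma>" "c d (k + 2) = c d k + \<sigma>"
      "c d (k + 3) = c d k + 2 * \<sigma>" by (rule shift)
    then have "c d (k + 2) \<noteq> c d (k + 3)" by auto
    then show ?thesis using * \<sigma> by (auto simp: slot_def numeral_eq_Suc)
  next
    case False
    then have f: "full k" "c (\<not> d) (k + 1) = c (\<not> d) k" using assms by (auto simp: slot_def)
    then have g: "\<bar>c d (k + 3) - c d k\<bar> \<le> 1" "\<bar>c (\<not> d) (k + 3) - c (\<not> d) k\<bar> \<le> 1"
      by (auto simp: full_def)
    have "c d (k + 2) \<noteq> c d (k + 3)"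
      using g f(2) column_diffs[of d k] column_diffs[of "\<not> d" k]
        distinct[of "k" "k + 1" d] distinct[of "k" "k + 2" d] distinct[of "k" "k + 3" d]
        distinct[of "k + 1" "k + 2" d] distinct[of "k + 1" "k + 3" d] distinct[of "k + 2" "k + 3" d]
      by simp (smt (verit))
    then show ?thesis using * full_Suc[OF f(1)] by (auto simp: slot_def numeral_eq_Suc)
  qed
qed

text \<open>A full block at 0 may begin with a diagonal step and then has no slot, whence the bound
  \<open>k \<ge> 1\<close>. In that case 1 is not full; so a slot exists at 1 in any case, and
  \<open>slot_Suc\<close> propagates it.\<close>

lemma slots_alternate: "\<exists>e. \<forall>k\<ge>1. slot (even k = e) k"
proof -
  have "\<exists>d. slot d 1"
  proof (cases "full 0")
    case True
    then have "\<not> full 1" using full_Suc[of 0] by simp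
    then obtain d where "\<bar>c d (1 + 3) - c d 1\<bar> > 1" unfolding full_def by (meson not_le)
    then show ?thesis unfolding slot_def by blast
  next
    case False
    then obtain d where "\<bar>c d (0 + 3) - c d 0\<bar> > 1" unfolding full_def by (meson not_le)
    then have "slot d 0" unfolding slot_def by blast
    then show ?thesis using slot_Suc[of d 0] by auto
  qed
  then obtain d where d: "slot d 1" by blast
  have "slot (even k = (\<not> d)) k" if "k \<ge> 1" for k
    using that
  proof (induction k rule: dec_induct)
    case (step k)
    then show ?case using slot_Suc[of "even k = (\<not> d)" k] by simp
  qed (use d in simp)
  then show ?thesis by blast
qed

end

section \<open>Runs of shifts and gaps between full blocks\<close>

locale slotted_path = cell_path +
  fixes e :: bool
  assumes slots: "\<And>k. k \<ge> 1 \<Longrightarrow> slot (even k = e) k"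
begin

abbreviation dir :: "nat \<Rightarrow> bool" where
  "dir k \<equiv> (even k = e)"

text \<open>Shifts two indices apart share the step from \<open>k + 2 * m + 2\<close> to
  \<open>k + 2 * m + 3\<close>. A change of sign would put cell \<open>k + 2 * m + 2\<close> two
  columns away from its predecessor.\<close>

lemma run:
  assumes "k \<ge> 1" "\<And>i. i \<le> m \<Longrightarrow> \<not> full (k + 2 * i)"
  shows "\<exists>\<sigma>. \<bar>\<sigma>\<bar> = 1 \<and> c (dir k) (k + 2 * m) = c (dir k) k + int m * \<sigma> \<and>
    c (dir k) (k + 2 * m + 1) = c (dir k) k + int (m + 1) * \<sigma> \<and>
    c (dir k) (k + 2 * m + 3) = c (dir k) k + int (m + 2) * \<sigma>"
  using assms(2)
proof (induction m)
  case 0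
  then have "\<bar>c (dir k) (k + 3) - c (dir k) k\<bar> > 1"
    using slots[OF assms(1)] by (auto simp: slot_def)
  then obtain \<sigma> where "\<bar>\<sigma>\<bar> = 1" "c (dir k) (k + 1) = c (dir k) k + \<sigma>"
    "c (dir k) (k + 3) = c (dir k) k + 2 * \<sigma>" by (rule shift)
  then show ?case by (intro exI[of _ \<sigma>]) simp
next
  case (Suc m)
  then obtain \<sigma> where \<sigma>: "\<bar>\<sigma>\<bar> = 1"
    "c (dir k) (k + 2 * m + 1) = c (dir k) k + int (m + 1) * \<sigma>"
    "c (dir k) (k + 2 * m + 3) = c (dir k) k + int (m + 2) * \<sigma>" by auto
  let ?l = "k + 2 * Suc m"
  have "\<bar>c (dir k) (?l + 3) - c (dir k) ?l\<bar> > 1"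
    using slots[of ?l] Suc.prems[of "Suc m"] assms(1) by (auto simp: slot_def)
  then obtain \<tau> where \<tau>: "\<bar>\<tau>\<bar> = 1" "c (dir k) (?l + 1) = c (dir k) ?l + \<tau>"
    "c (dir k) (?l + 3) = c (dir k) ?l + 2 * \<tau>" by (rule shift)
  have "\<bar>c (dir k) ?l - c (dir k) (k + 2 * m + 1)\<bar> \<le> 1" by (intro column_diff) auto
  with \<sigma> \<tau> have "\<tau> = \<sigma>" "c (dir k) ?l = c (dir k) k + int (m + 1) * \<sigma>"
    by (auto simp: algebra_simps numeral_eq_Suc abs_if split: if_splits)
  with \<sigma>(1) \<tau>(2,3) show ?case
    by (intro exI[of _ \<sigma>]) (auto simp: algebra_simps)
qed

text \<open>The columns differ by \<open>m + 2\<close>, of which at most 1 is lost through the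
  positions inside the two end cells.\<close>

lemma run_displacement:
  assumes "k \<ge> 1" "\<And>i. i \<le> m \<Longrightarrow> \<not> full (k + 2 * i)"
  shows "\<exists>\<sigma>. \<bar>\<sigma>\<bar> = 1 \<and> real m + 1 \<le> \<sigma> * (p (dir k) (k + 2 * m + 3) - p (dir k) k)"
proof -
  obtain \<sigma> where \<sigma>: "\<bar>\<sigma>\<bar> = 1"
    and "c (dir k) (k + 2 * m + 3) = c (dir k) k + int (m + 2) * \<sigma>"
    using run[of k m] assms by blast
  then have "real_of_int (c (dir k) (k + 2 * m + 3)) = c (dir k) k + (real m + 2) * \<sigma>"
    by simp
  moreover have "\<sigma> = 1 \<or> \<sigma> = -1" using \<sigma> by linarith
  ultimately show ?thesis
    using cell[of "dir k" k] cell[of "dir k" "k + 2 * m + 3"]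
    by (intro exI[of _ "real_of_int \<sigma>"]) auto
qed

text \<open>An endless run would cover \<open>m + 1\<close> in \<open>2 * m + 3\<close> steps, an
  average of nearly 1/2 per step, which exceeds \<open>R\<close> for large \<open>m\<close>.\<close>

lemma full_recurs:
  assumes "k \<ge> 1"
  shows "\<exists>i. full (k + 2 * i)"
proof (rule ccontr)
  assume none: "\<not> ?thesis"
  obtain m where m: "real m * (1 - 2 * R) > 3 * R"
    using reals_Archimedean3[of "1 - 2 * R"] R by auto
  obtain \<sigma> where "\<bar>\<sigma>\<bar> = 1" "real m + 1 \<le> \<sigma> * (p (dir k) (k + 2 * m + 3) - p (dir k) k)"
    using run_displacement[of k m] assms none by auto
  then have "real m + 1 \<le> \<bar>p (dir k) (k + 2 * m + 3) - p (dir k) k\<bar>"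
    using abs_ge_self[of "\<sigma> * (p (dir k) (k + 2 * m + 3) - p (dir k) k)"] by (simp add: abs_mult)
  also have "\<dots> \<le> real (2 * m + 3) * R" using displacement[of "dir k" k "2 * m + 3"] by (simp add: add.assoc)
  finally show False using m by (simp add: algebra_simps)
qed

definition gap :: "nat \<Rightarrow> nat \<Rightarrow> bool" where
  "gap t K \<longleftrightarrow> t \<ge> 1 \<and> K \<ge> 1 \<and> full t \<and> full (t + 2 * K) \<and> (\<forall>i. 0 < i \<longrightarrow> i < K \<longrightarrow> \<not> full (t + 2 * i))"

lemma gap_exists:
  assumes "t \<ge> 1" "full t"
  shows "\<exists>K. gap t K"
proof -
  define K where "K = (LEAST K. K \<ge> 1 \<and> full (t + 2 * K))"
  obtain i where "full (t + 2 + 2 * i)" using full_recurs[of "t + 2"] by auto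
  then have "\<exists>K. K \<ge> 1 \<and> full (t + 2 * K)" by (intro exI[of _ "i + 1"]) simp
  then have "K \<ge> 1 \<and> full (t + 2 * K)" unfolding K_def by (rule LeastI_ex)
  moreover have "\<not> full (t + 2 * i)" if "0 < i" "i < K" for i
    using not_less_Least[of i "\<lambda>K. K \<ge> 1 \<and> full (t + 2 * K)"] that by (auto simp: K_def)
  ultimately show ?thesis using assms by (auto simp: gap_def)
qed

lemma gap_around:
  assumes "t \<ge> 1" "full t" "t < n"
  obtains s K where "gap s K" "even s = even t" "s < n" "n \<le> s + 2 * K"
proof -
  define A where "A = {s. 1 \<le> s \<and> s < n \<and> full s \<and> even s = even t}"
  have A: "finite A" "t \<in> A" using assms by (auto simp: A_def)
  then have "Max A \<in> A" by (intro Max_in) auto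
  then have s: "1 \<le> Max A" "Max A < n" "full (Max A)" "even (Max A) = even t" by (auto simp: A_def)
  then obtain K where K: "gap (Max A) K" using gap_exists by blast
  then have "Max A + 2 * K \<notin> A" using Max_ge[OF A(1), of "Max A + 2 * K"] by (auto simp: gap_def)
  then have "n \<le> Max A + 2 * K" using K s by (auto simp: A_def gap_def)
  then show thesis using that K s by blast
qed

text \<open>The shifts start at \<open>t + 2\<close>, ..., \<open>t + 2 * K - 2\<close>, and the
  last one ends at cell \<open>t + 2 * K + 1\<close>; this is a run with
  \<open>m = K - 2\<close>.\<close>

lemma gap_displacement:
  assumes "gap t K" "K \<ge> 2"
  shows "\<exists>\<sigma>. \<bar>\<sigma>\<bar> = 1 \<and> real K - 1 \<le> \<sigma> * (p (dir t) (t + 2 * K + 1) - p (dir t) (t + 2))"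
proof -
  obtain m where m: "K = m + 2" using assms(2) by (metis add.commute le_Suc_ex)
  have "\<not> full (t + 2 + 2 * i)" if "i \<le> m" for i
    using assms(1) that m by (auto simp: gap_def dest!: spec[of _ "i + 1"])
  then have "\<exists>\<sigma>. \<bar>\<sigma>\<bar> = 1 \<and>
      real m + 1 \<le> \<sigma> * (p (dir (t + 2)) (t + 2 + 2 * m + 3) - p (dir (t + 2)) (t + 2))"
    by (intro run_displacement) auto
  moreover have "t + 2 + 2 * m + 3 = t + 2 * K + 1" "dir (t + 2) = dir t" "real m + 1 = real K - 1"
    using m by simp_all
  ultimately show ?thesis by (simp only:)
qed

lemma full_apart: "full s \<Longrightarrow> full t \<Longrightarrow> t \<noteq> s + 1"
  using full_Suc by blast

end

section \<open>The alternating chain of long gaps\<close>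

text \<open>A stretch with \<open>K = 3\<close> must gain \<open>2 - R\<close> in its four shared
  steps, one with \<open>K \<ge> 4\<close> at least \<open>3 - 3 * R\<close>, hence at least
  \<open>D\<close>. \<open>S\<close> bounds the weighted step for either assignment of the weights,
  and is below the average needed to serve both demands in four steps. The last assumption excludes
  two adjacent short stretches unless the demands agree.\<close>

locale weighted_path = slotted_path +
  fixes \<alpha> \<beta> S D :: real
  assumes weights: "0 < \<alpha>" "\<alpha> \<le> \<beta>"
    and weighted_step:
      "\<alpha> * \<bar>p d (Suc k) - p d k\<bar> + \<beta> * \<bar>p (\<not> d) (Suc k) - p (\<not> d) k\<bar> \<le> S"
    and S: "S < (\<alpha> * (2 - R) + \<beta> * D) / 4"
    and D: "2 - R \<le> D" "D \<le> 3 - 3 * R"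
    and short_gaps: "D \<le> 2 - R \<or>
      (\<forall>t\<ge>1. full t \<longrightarrow> full (t + 3) \<longrightarrow> full (t + 6) \<longrightarrow> \<not> full (t + 9))"
begin

lemma weighted_displacement:
  "\<alpha> * \<bar>p d (k + n) - p d k\<bar> + \<beta> * \<bar>p (\<not> d) (k + n) - p (\<not> d) k\<bar> \<le> real n * S"
proof (induction n)
  case (Suc n)
  have "\<alpha> * \<bar>p d (k + Suc n) - p d k\<bar> \<le> \<alpha> * (\<bar>p d (k + n) - p d k\<bar> + \<bar>p d (Suc (k + n)) - p d (k + n)\<bar>)"
    using weights by (intro mult_left_mono) auto
  moreover have "\<beta> * \<bar>p (\<not> d) (k + Suc n) - p (\<not> d) k\<bar> \<le>
      \<beta> * (\<bar>p (\<not> d) (k + n) - p (\<not> d) k\<bar> + \<bar>p (\<not> d) (Suc (k + n)) - p (\<not> d) (k + n)\<bar>)"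
    using weights by (intro mult_left_mono) auto
  ultimately show ?case using Suc.IH weighted_step[of d "k + n"] by (simp add: algebra_simps)
qed simp

text \<open>The stretch has \<open>2 * K - 1\<close> steps, and each step outside the window
  contributes at most \<open>R\<close> to the required \<open>K - 1\<close>.\<close>

lemma gap_window:
  assumes "gap t K" "K \<ge> 2" "t + 2 \<le> j" "j + n \<le> t + 2 * K + 1"
  shows "real K - 1 - (2 * real K - 1 - real n) * R \<le> \<bar>p (dir t) (j + n) - p (dir t) j\<bar>"
proof -
  let ?p = "p (dir t)"
  obtain \<sigma> where \<sigma>: "\<bar>\<sigma>\<bar> = 1" "real K - 1 \<le> \<sigma> * (?p (t + 2 * K + 1) - ?p (t + 2))"
    using gap_displacement[OF assms(1,2)] by blast
  have "\<sigma> * (?p (t + 2 * K + 1) - ?p (t + 2)) \<le> \<bar>?p (t + 2 * K + 1) - ?p (t + 2)\<bar>"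
    using abs_ge_self[of "\<sigma> * (?p (t + 2 * K + 1) - ?p (t + 2))"] \<sigma>(1) by (simp add: abs_mult)
  also have "\<dots> \<le> \<bar>?p j - ?p (t + 2)\<bar> + \<bar>?p (j + n) - ?p j\<bar> + \<bar>?p (t + 2 * K + 1) - ?p (j + n)\<bar>"
    by linarith
  finally have "real K - 1 \<le> \<dots>" using \<sigma>(2) by linarith
  moreover have "\<bar>?p j - ?p (t + 2)\<bar> \<le> (real j - real t - 2) * R"
  proof -
    have "t + 2 + (j - (t + 2)) = j" "real (j - (t + 2)) = real j - real t - 2"
      using assms(3) by (simp_all add: of_nat_diff)
    then show ?thesis using displacement[of "dir t" "t + 2" "j - (t + 2)"] by metis
  qed
  moreover have "\<bar>?p (t + 2 * K + 1) - ?p (j + n)\<bar> \<le> (real t + 2 * real K + 1 - real j - real n) * R"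
    using displacement[of "dir t" "j + n" "t + 2 * K + 1 - (j + n)"] assms(4)
    by (simp add: of_nat_diff algebra_simps)
  ultimately show ?thesis by (simp add: algebra_simps)
qed

lemma gaps_overlap_short:
  assumes "gap t K" "gap s L" "dir s \<noteq> dir t" "K \<ge> 3" "L \<ge> 4"
    "t + 2 \<le> j" "j + 4 \<le> t + 2 * K + 1" "s + 2 \<le> j" "j + 4 \<le> s + 2 * L + 1"
  shows False
proof -
  have dir: "dir s = (\<not> dir t)" using assms(3) by blast
  \<comment> \<open>Since \<open>2 * R < 1\<close>, the demand
    \<open>K - 1 - (2 * K - 5) * R\<close> increases with \<open>K\<close>; it is
    \<open>2 - R\<close> at 3 and \<open>3 - 3 * R\<close> at 4.\<close>
  have "0 \<le> (real K - 3) * (1 - 2 * R)" using assms(4) R by simp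
  then have "2 - R \<le> real K - 1 - (2 * real K - 1 - real 4) * R" by (simp add: algebra_simps)
  then have 1: "2 - R \<le> \<bar>p (dir t) (j + 4) - p (dir t) j\<bar>"
    using gap_window[of t K j 4] assms by linarith
  have "0 \<le> (real L - 4) * (1 - 2 * R)" using assms(5) R by simp
  then have "D \<le> real L - 1 - (2 * real L - 1 - real 4) * R" using D(2) by (simp add: algebra_simps)
  then have 2: "D \<le> \<bar>p (\<not> dir t) (j + 4) - p (\<not> dir t) j\<bar>"
    using gap_window[of s L j 4] assms unfolding dir by linarith
  have "\<alpha> * (2 - R) + \<beta> * D \<le> 4 * S"
  proof -
    have "\<alpha> * (2 - R) \<le> \<alpha> * \<bar>p (dir t) (j + 4) - p (dir t) j\<bar>"
      using 1 weights by (intro mult_left_mono) auto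
    moreover have "\<beta> * D \<le> \<beta> * \<bar>p (\<not> dir t) (j + 4) - p (\<not> dir t) j\<bar>"
      using 2 weights by (intro mult_left_mono) auto
    ultimately show ?thesis using weighted_displacement[of "dir t" j 4] by linarith
  qed
  then show False using S by simp
qed

text \<open>The full block of the other parity before the end is what allows
  \<open>gap_around\<close> to find a gap crossing that end.\<close>

definition major :: "nat \<Rightarrow> nat \<Rightarrow> bool" where
  "major t K \<longleftrightarrow> gap t K \<and> K \<ge> 3 \<and> (\<exists>s\<ge>1. full s \<and> even s \<noteq> even t \<and> s < t + 2 * K)"

text \<open>
  The next long stretch begins three steps before the present one ends: an earlier beginning
  would give an overlap of four steps, a later one is excluded by parity and \<open>full_apart\<close>.
\<close>

lemma major_next:
  assumes "major t K"
  shows "\<exists>L. major (t + 2 * K - 3) L"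
proof -
  have K: "gap t K" "K \<ge> 3" using assms by (auto simp: major_def)
  obtain s where "s \<ge> 1" "full s" "even s \<noteq> even t" "s < t + 2 * K"
    using assms by (auto simp: major_def)
  then obtain s L where s: "gap s L" "even s \<noteq> even t" "s < t + 2 * K" "t + 2 * K \<le> s + 2 * L"
    by (metis gap_around)
  have full: "full s" "full (s + 2 * L)" "full (t + 2 * K)" using s(1) K(1) by (auto simp: gap_def)
  have "s + 1 \<noteq> t + 2 * K" "s + 2 * L \<noteq> t + 2 * K + 1" "s + 2 * L \<noteq> t + 2 * K"
    using full_apart[OF full(1,3)] full_apart[OF full(3,2)] s(2) by (auto dest: arg_cong[of _ _ even])
  moreover have "s + 2 \<noteq> t + 2 * K" "s + 2 * L \<noteq> t + 2 * K + 2" "s + 4 \<noteq> t + 2 * K"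
    using s(2) by (auto dest: arg_cong[of _ _ even])
  ultimately have *: "s + 3 = t + 2 * K \<or> s + 5 \<le> t + 2 * K" "t + 2 * K + 3 \<le> s + 2 * L"
    using s(3,4) by linarith+
  have "\<not> s + 5 \<le> t + 2 * K"
  proof
    assume s5: "s + 5 \<le> t + 2 * K"
    \<comment> \<open>The window consists of the last four steps of the present stretch. The
      crossing gap spans at least from \<open>t + 2 * K - 5\<close> to \<open>t + 2 * K + 3\<close>,
      so \<open>L \<ge> 4\<close>.\<close>
    have "t + 2 \<le> t + 2 * K - 3" "s + 2 \<le> t + 2 * K - 3" "t + 2 * K - 3 + 4 = t + 2 * K + 1" "L \<ge> 4"
      using s5 K(2) *(2) by linarith+
    then show False
      by (intro gaps_overlap_short[of t K s L "t + 2 * K - 3"])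
        (use K s(1,2) *(2) in \<open>(assumption | linarith | blast)\<close>)+
  qed
  then have "s = t + 2 * K - 3" using * by simp
  moreover have "major s L"
    using s(1,2) * \<open>\<not> s + 5 \<le> t + 2 * K\<close> full(3) K by (auto simp: major_def gap_def intro!: exI[of _ "t + 2 * K"])
  ultimately show ?thesis by blast
qed

text \<open>Full blocks of both parities occur. If the gap beginning at one of them is too short, a
  gap of the other parity straddles that block. By parity and \<open>full_apart\<close> both of its
  ends are at distance at least 3 from the block, so its length parameter is at least 3.\<close>

lemma major_exists: "\<exists>t K. major t K"
proof -
  obtain s where s: "s \<ge> 1" "full s" using full_recurs[of 1] that by fastforce
  obtain i where t: "full (s + 1 + 2 * i)" using full_recurs[of "s + 1"] s by auto
  let ?t = "s + 1 + 2 * i"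
  obtain K where K: "gap ?t K" using gap_exists[of ?t] t by auto
  show ?thesis
  proof (cases "K \<ge> 3")
    case True
    then have "major ?t K"
      unfolding major_def using K s by (intro conjI exI[of _ s]) auto
    then show ?thesis by blast
  next
    case False
    obtain s' L where s': "gap s' L" "even s' = even s" "s' < ?t" "?t \<le> s' + 2 * L"
      using gap_around[of s ?t] s by auto
    have full: "full s'" "full (s' + 2 * L)" "full ?t" "full (?t + 2 * K)" "K \<ge> 1"
      using s' K by (auto simp: gap_def)
    have "s' + 1 \<noteq> ?t" "s' + 2 * L \<noteq> ?t + 1" "s' + 2 * L + 1 \<noteq> ?t + 2 * K" "s' + 2 * L \<noteq> ?t + 2 * K + 1"
      using full full_apart by metis+
    moreover have "s' + 2 * L \<noteq> ?t" "s' + 2 * L \<noteq> ?t + 2" "s' + 2 \<noteq> ?t" "s' + 2 * L \<noteq> ?t + 4"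
      using s'(2) by (auto dest: arg_cong[of _ _ even])
    ultimately have "L \<ge> 3" "?t < s' + 2 * L" using s'(3,4) False full(5) by presburger+
    then have "major s' L"
      unfolding major_def using s' full(3) by (intro conjI exI[of _ ?t]) auto
    then show ?thesis by blast
  qed
qed

lemma no_weighted_path: False
proof -
  obtain f :: "nat \<Rightarrow> nat \<times> nat" where
    maj: "\<And>n. major (fst (f n)) (snd (f n))" and
    nxt: "\<And>n. fst (f (Suc n)) = fst (f n) + 2 * snd (f n) - 3"
  proof -
    have "\<exists>f. \<forall>n. major (fst (f n)) (snd (f n)) \<and> fst (f (Suc n)) = fst (f n) + 2 * snd (f n) - 3"
    proof (rule dependent_nat_choice)
      show "\<exists>x. major (fst x) (snd x)" using major_exists by simp
      show "\<exists>y. major (fst y) (snd y) \<and> fst y = fst x + 2 * snd x - 3"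
        if "major (fst x) (snd x)" for x n
        using major_next[OF that] by auto
    qed
    then show thesis using that by metis
  qed
  define T K where "T n = fst (f n)" and "K n = snd (f n)" for n
  have gap: "gap (T n) (K n)" and K: "K n \<ge> 3" for n
    using maj[of n] by (auto simp: major_def T_def K_def)
  have T: "T (Suc n) + 3 = T n + 2 * K n" for n
    using nxt[of n] K[of n] by (simp add: T_def K_def)
  have odd: "even (T (Suc n)) \<noteq> even (T n)" for n
    using T[of n] by presburger
  have dir: "dir (T (Suc n)) = (\<not> dir (T n))" for n using odd[of n] by blast
  have "\<exists>\<sigma>. \<bar>\<sigma>\<bar> = 1 \<and>
      real (K n) - 1 \<le> \<sigma> * (p (dir (T n)) (T n + 2 * K n + 1) - p (dir (T n)) (T n + 2))" for n
    using gap_displacement[OF gap[of n]] K[of n] by simp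
  then obtain \<sigma> where \<sigma>: "\<And>n. \<bar>\<sigma> n\<bar> = 1"
    "\<And>n. real (K n) - 1 \<le> \<sigma> n * (p (dir (T n)) (T n + 2 * K n + 1) - p (dir (T n)) (T n + 2))"
    by metis
  \<comment> \<open>\<open>q n\<close> belongs to the first two steps of a stretch and
    \<open>r n\<close> to the last two. The last two are also the first two of stretch
    \<open>Suc n\<close>, in the other coordinate.\<close>
  define q where "q n = \<sigma> n * (p (dir (T n)) (T n + 4) - p (dir (T n)) (T n + 2))" for n
  define r where "r n = \<sigma> n * (p (dir (T n)) (T n + 2 * K n + 1) - p (dir (T n)) (T n + 2 * K n - 1))" for n
  \<comment> \<open>When both demands agree, every stretch counts as long and the alternation
    condition \<open>BB\<close> holds trivially.\<close>
  define B where "B n \<longleftrightarrow> K n \<ge> 4 \<or> D \<le> 2 - R" for n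
  have q: "\<bar>q n\<bar> = \<bar>p (dir (T n)) (T n + 4) - p (dir (T n)) (T n + 2)\<bar>" for n
    by (simp add: q_def abs_mult \<sigma>(1))
  have r: "\<bar>r n\<bar> = \<bar>p (\<not> dir (T (Suc n))) (T (Suc n) + 4) - p (\<not> dir (T (Suc n))) (T (Suc n) + 2)\<bar>" for n
  proof -
    have index: "T n + 2 * K n - 1 = T (Suc n) + 2" "T n + 2 * K n + 1 = T (Suc n) + 4"
      using T[of n] by simp_all
    show ?thesis unfolding r_def dir[of n] index abs_mult \<sigma>(1) by simp
  qed
  have corner: "\<alpha> * r n + \<beta> * q (Suc n) \<le> 2 * S" "\<beta> * r n + \<alpha> * q (Suc n) \<le> 2 * S" for n
  proof -
    define d where "d = dir (T (Suc n))"
    have "T (Suc n) + 2 + 2 = T (Suc n) + 4" by simp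
    then have "\<alpha> * \<bar>r n\<bar> + \<beta> * \<bar>q (Suc n)\<bar> \<le> 2 * S" "\<alpha> * \<bar>q (Suc n)\<bar> + \<beta> * \<bar>r n\<bar> \<le> 2 * S"
      using weighted_displacement[of "\<not> d" "T (Suc n) + 2" 2] weighted_displacement[of d "T (Suc n) + 2" 2]
      unfolding q r d_def[symmetric] not_not of_nat_numeral by (simp_all only:)
    moreover have "\<alpha> * r n \<le> \<alpha> * \<bar>r n\<bar>" "\<beta> * q (Suc n) \<le> \<beta> * \<bar>q (Suc n)\<bar>"
      "\<beta> * r n \<le> \<beta> * \<bar>r n\<bar>" "\<alpha> * q (Suc n) \<le> \<alpha> * \<bar>q (Suc n)\<bar>"
      using weights by (auto intro!: mult_left_mono)
    ultimately show "\<alpha> * r n + \<beta> * q (Suc n) \<le> 2 * S" "\<beta> * r n + \<alpha> * q (Suc n) \<le> 2 * S"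
      by linarith+
  qed
  have sum: "(if B n then D else 2 - R) \<le> q n + r n" for n
  proof -
    let ?p = "p (dir (T n))"
    have "\<bar>?p (T n + 2 * K n - 1) - ?p (T n + 4)\<bar> \<le> (2 * real (K n) - 5) * R"
      using displacement[of "dir (T n)" "T n + 4" "2 * K n - 5"] K[of n] by (simp add: of_nat_diff)
    moreover have "\<sigma> n * (?p (T n + 2 * K n - 1) - ?p (T n + 4)) \<le> \<bar>?p (T n + 2 * K n - 1) - ?p (T n + 4)\<bar>"
      using abs_ge_self[of "\<sigma> n * (?p (T n + 2 * K n - 1) - ?p (T n + 4))"] \<sigma>(1) by (simp add: abs_mult)
    ultimately have *: "real (K n) - 1 - (2 * real (K n) - 5) * R \<le> q n + r n"
      using \<sigma>(2)[of n] by (simp add: q_def r_def algebra_simps)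
    have "0 \<le> (real (K n) - 3) * (1 - 2 * R)" using K[of n] R by simp
    then have 3: "2 - R \<le> q n + r n" using * by (simp add: algebra_simps)
    have "D \<le> q n + r n" if "K n \<ge> 4"
    proof -
      have "0 \<le> (real (K n) - 4) * (1 - 2 * R)" using that R by simp
      then show ?thesis using * D(2) by (simp add: algebra_simps)
    qed
    with 3 show ?thesis by (auto simp: B_def)
  qed
  have BB: "B n \<or> B (Suc n)" for n
  proof (rule ccontr)
    assume "\<not> ?thesis"
    then have K3: "K n = 3" "K (Suc n) = 3" and D': "\<not> D \<le> 2 - R"
      using K[of n] K[of "Suc n"] by (auto simp: B_def)
    then have "T (Suc n) = T n + 3" using T[of n] by simp
    then have "full (T n)" "full (T n + 3)" "full (T n + 6)" "full (T n + 9)" "T n \<ge> 1"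
      using gap[of n] gap[of "Suc n"] by (auto simp: gap_def K3 numeral_eq_Suc)
    then show False using short_gaps D' by blast
  qed
  show False
  proof (rule no_bounded_weighted_chain[where q = q and r = r and B = B, OF weights D(1) sum BB corner])
    show "2 * S < (\<alpha> * (2 - R) + \<beta> * D) / 2" using S by simp
    show "\<bar>q n\<bar> \<le> 2 * R" for n
    proof -
      have "T n + 2 + 2 = T n + 4" by simp
      then show ?thesis
        using displacement[of "dir (T n)" "T n + 2" 2] unfolding q of_nat_numeral by (simp only:)
    qed
  qed
qed

end

section \<open>Finiteness of components\<close>

text \<open>Koenig's lemma along geodesics: one of the finitely many successors again lies on
  geodesics to infinitely many vertices. Vertex \<open>f n\<close> then has distance exactly
  \<open>n\<close> from \<open>a\<close>, which makes the ray injective.\<close>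

lemma infinite_reachable_ray:
  fixes E :: "('a \<times> 'a) set"
  assumes inf: "infinite {v. (a, v) \<in> E\<^sup>*}" and fin: "\<And>v. finite (E `` {v})"
  obtains f :: "nat \<Rightarrow> 'a" where "inj f" "f 0 = a" "\<And>n. (f n, f (Suc n)) \<in> E"
proof -
  \<comment> \<open>\<open>G n v\<close>: the vertices for which some geodesic from \<open>a\<close> passes through \<open>v\<close> after \<open>n\<close> steps\<close>
  define G where "G n v = {w. \<exists>k. (v, w) \<in> E ^^ k \<and> (\<forall>j<n + k. (a, w) \<notin> E ^^ j)}" for n v
  have "\<exists>f. f 0 = a \<and> (\<forall>n. infinite (G n (f n)) \<and> (f n, f (Suc n)) \<in> E)"
  proof -
    have "\<exists>f. \<forall>n. (infinite (G n (f n)) \<and> (n = 0 \<longrightarrow> f n = a)) \<and> (f n, f (Suc n)) \<in> E"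
    proof (rule dependent_nat_choice)
      have "{v. (a, v) \<in> E\<^sup>*} \<subseteq> G 0 a"
      proof
        fix v assume "v \<in> {v. (a, v) \<in> E\<^sup>*}"
        then have "\<exists>k. (a, v) \<in> E ^^ k" by (simp add: rtrancl_power)
        then show "v \<in> G 0 a"
          unfolding G_def using exists_least_iff[of "\<lambda>k. (a, v) \<in> E ^^ k"] by auto
      qed
      then show "\<exists>x. infinite (G 0 x) \<and> (0 = (0::nat) \<longrightarrow> x = a)"
        using inf finite_subset by blast
      show "\<exists>y. (infinite (G (Suc n) y) \<and> (Suc n = 0 \<longrightarrow> y = a)) \<and> (x, y) \<in> E"
        if "infinite (G n x) \<and> (n = 0 \<longrightarrow> x = a)" for x n
      proof (rule ccontr)
        assume none: "\<not> ?thesis"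
        have "G n x \<subseteq> {x} \<union> (\<Union>y\<in>E `` {x}. G (Suc n) y)"
        proof
          fix w assume "w \<in> G n x"
          then obtain k where k: "(x, w) \<in> E ^^ k" "\<forall>j<n + k. (a, w) \<notin> E ^^ j" by (auto simp: G_def)
          show "w \<in> {x} \<union> (\<Union>y\<in>E `` {x}. G (Suc n) y)"
          proof (cases k)
            case (Suc l)
            then obtain y where "(x, y) \<in> E" "(y, w) \<in> E ^^ l" using k(1) by (meson relpow_Suc_D2)
            then have "w \<in> G (Suc n) y" using k(2) Suc by (auto simp: G_def)
            then show ?thesis using \<open>(x, y) \<in> E\<close> by blast
          qed (use k in auto)
        qed
        moreover have "finite ({x} \<union> (\<Union>y\<in>E `` {x}. G (Suc n) y))" using none fin by auto
        ultimately show False using that finite_subset by blast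
      qed
    qed
    then show ?thesis by blast
  qed
  then obtain f where f: "f 0 = a" "\<And>n. infinite (G n (f n))" "\<And>n. (f n, f (Suc n)) \<in> E" by blast
  have reach: "(a, f n) \<in> E ^^ n" for n
    by (induction n) (use f in auto)
  have "f i \<noteq> f j" if "i < j" for i j
  proof
    assume eq: "f i = f j"
    obtain w where "w \<in> G j (f j)" using f(2)[of j] by (metis finite.emptyI ex_in_conv)
    then obtain k where k: "(f j, w) \<in> E ^^ k" "\<forall>m<j + k. (a, w) \<notin> E ^^ m" by (auto simp: G_def)
    have "(a, w) \<in> E ^^ (i + k)" using reach[of i] k(1) eq by (auto simp: relpow_add)
    then show False using k(2) that by auto
  qed
  then have "inj f" by (metis injI linorder_neqE_nat)
  then show thesis using f that by blast
qed

definition coord :: "bool \<Rightarrow> 'a \<times> 'a \<Rightarrow> 'a" where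
  "coord d v = (if d then fst v else snd v)"

lemma infinite_component_path:
  assumes P: "P \<in> point_collections" and R: "R < 1 / 2"
    and E: "E \<subseteq> {(u, v). \<forall>d. \<bar>coord d (P u) - coord d (P v)\<bar> \<le> R}"
    and inf: "infinite (component0 E)"
  obtains f where "cell_path (\<lambda>d n. coord d (f n)) (\<lambda>d n. coord d (P (f n))) R" "\<And>n. (f n, f (Suc n)) \<in> E"
proof -
  have cell: "real_of_int (coord d v) \<le> coord d (P v)" "coord d (P v) \<le> real_of_int (coord d v) + 1" for d v
    using P by (cases v; auto simp: point_collections_def coord_def mem_Times_iff)+
  have near: "\<bar>coord d u - coord d v\<bar> \<le> 1" if "(u, v) \<in> E" for u v d
  proof -
    have "\<bar>coord d (P u) - coord d (P v)\<bar> \<le> R" using E that by blast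
    then have "real_of_int (coord d u) - real_of_int (coord d v) < 2"
      "real_of_int (coord d v) - real_of_int (coord d u) < 2"
      using R cell[of d u] cell[of d v] by linarith+
    then show ?thesis by linarith
  qed
  have "finite (E `` {v})" for v
  proof (rule finite_subset)
    show "E `` {v} \<subseteq> {fst v - 1..fst v + 1} \<times> {snd v - 1..snd v + 1}"
      using near[of v _ True] near[of v _ False] by (fastforce simp: coord_def)
  qed simp
  with inf obtain f where f: "inj f" "\<And>n. (f n, f (Suc n)) \<in> E"
    unfolding component0_def by (metis infinite_reachable_ray)
  show thesis
  proof (rule that)
    show "cell_path (\<lambda>d n. coord d (f n)) (\<lambda>d n. coord d (P (f n))) R"
    proof
      show "\<bar>coord d (P (f (Suc k))) - coord d (P (f k))\<bar> \<le> R" for d k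
        using f(2)[of k] E by (auto simp: abs_minus_commute)
      show "inj (\<lambda>k. (coord True (f k), coord False (f k)))"
        using f(1) by (auto simp: inj_def coord_def prod_eq_iff)
    qed (use R cell in auto)
  qed (rule f)
qed

text \<open>With unit axis steps, step \<open>k + 2\<close> is opposite to step \<open>k\<close> if
  \<open>full k\<close> holds and equal to it otherwise. Full blocks at spacing 3 then make twelve
  steps sum to zero, so a cell is revisited.\<close>

lemma (in slotted_path) orthogonal_short_gaps:
  assumes orth: "\<And>k. \<bar>c True (Suc k) - c True k\<bar> + \<bar>c False (Suc k) - c False k\<bar> = 1"
    and "full t" "full (t + 3)" "full (t + 6)" "t \<ge> 1"
  shows "\<not> full (t + 9)"
proof
  assume t9: "full (t + 9)"
  define v where "v d k = c d (Suc k) - c d k" for d k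
  have dist: "k \<noteq> l \<Longrightarrow> c True k \<noteq> c True l \<or> c False k \<noteq> c False l" for k l
    using distinct[of k l True] by simp
  have vf: "v d (k + 2) = - v d k" if "full k" for d k
  proof -
    have "\<bar>c True (k + 3) - c True k\<bar> \<le> 1" "\<bar>c False (k + 3) - c False k\<bar> \<le> 1"
      using that by (auto simp: full_def)
    then have "v True (k + 2) = - v True k \<and> v False (k + 2) = - v False k"
      using orth[of k] orth[of "k + 1"] orth[of "k + 2"] column_diffs[of True k] column_diffs[of False k]
        dist[of k "k + 2"] dist[of "k + 1" "k + 3"] dist[of k "k + 3"]
      unfolding v_def by (simp add: numeral_eq_Suc) (smt (verit))
    then show ?thesis by (cases d) auto
  qed
  have vn: "v d (k + 2) = v d k" if nf: "\<not> full k" for d k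
  proof -
    obtain b where "\<bar>c b (k + 3) - c b k\<bar> > 1" using nf by (auto simp: full_def not_le)
    then obtain \<sigma> where "\<bar>\<sigma>\<bar> = 1" "c b (k + 1) = c b k + \<sigma>" "c b (k + 2) = c b k + \<sigma>" "c b (k + 3) = c b k + 2 * \<sigma>"
      by (rule shift)
    then have "v True (k + 2) = v True k \<and> v False (k + 2) = v False k"
      using orth[of k] orth[of "k + 1"] orth[of "k + 2"]
      unfolding v_def by (cases b; simp add: numeral_eq_Suc; smt (verit))
    then show ?thesis by (cases d) auto
  qed
  have nf: "\<not> full (t + 1)" "\<not> full (t + 2)" "\<not> full (t + 4)" "\<not> full (t + 5)" "\<not> full (t + 7)" "\<not> full (t + 8)"
    using full_apart[of t "t + 1"] full_apart[of "t + 2" "t + 3"] full_apart[of "t + 3" "t + 4"] full_apart[of "t + 5" "t + 6"]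
      full_apart[of "t + 6" "t + 7"] full_apart[of "t + 8" "t + 9"] assms(2-4) t9
    by (auto simp: numeral_eq_Suc)
  \<comment> \<open>the four full blocks turn the path once around a plus-shaped cycle\<close>
  have "c d (t + 12) = c d t" for d
  proof -
    have "c d (t + 12) - c d t = v d t + v d (t + 1) + v d (t + 2) + v d (t + 3) + v d (t + 4) + v d (t + 5)
        + v d (t + 6) + v d (t + 7) + v d (t + 8) + v d (t + 9) + v d (t + 10) + v d (t + 11)"
      by (simp add: v_def numeral_eq_Suc)
    also have "\<dots> = 0"
      using vf[OF assms(2), of d] vn[OF nf(1), of d] vn[OF nf(2), of d] vf[OF assms(3), of d] vn[OF nf(3), of d]
        vn[OF nf(4), of d] vf[OF assms(4), of d] vn[OF nf(5), of d] vn[OF nf(6), of d] vf[OF t9, of d]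
      by (simp add: numeral_eq_Suc)
    finally show ?thesis by simp
  qed
  then show False using dist[of t "t + 12"] by simp
qed

lemma finite_component0:
  fixes D :: real
  assumes P: "P \<in> point_collections" and R: "R < 1 / 2"
    and E: "E \<subseteq> {(u, v). \<forall>d. \<bar>coord d (P u) - coord d (P v)\<bar> \<le> R \<and>
        \<alpha> * \<bar>coord d (P u) - coord d (P v)\<bar> + \<beta> * \<bar>coord (\<not> d) (P u) - coord (\<not> d) (P v)\<bar> \<le> S}"
    and weights: "0 < \<alpha>" "\<alpha> \<le> \<beta>" and S: "S < (\<alpha> * (2 - R) + \<beta> * D) / 4"
    and D: "2 - R \<le> D" "D \<le> 3 - 3 * R"
    and short: "D \<le> 2 - R \<or> E \<subseteq> {(u, v). \<bar>fst u - fst v\<bar> + \<bar>snd u - snd v\<bar> = 1}"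
  shows "finite (component0 E)"
proof (rule ccontr)
  assume "infinite (component0 E)"
  moreover have "E \<subseteq> {(u, v). \<forall>d. \<bar>coord d (P u) - coord d (P v)\<bar> \<le> R}" using E by blast
  ultimately obtain f where f: "cell_path (\<lambda>d n. coord d (f n)) (\<lambda>d n. coord d (P (f n))) R"
    and fE: "\<And>n. (f n, f (Suc n)) \<in> E"
    using infinite_component_path[OF P R] by blast
  interpret cell_path "\<lambda>d n. coord d (f n)" "\<lambda>d n. coord d (P (f n))" R by (rule f)
  obtain e where "\<forall>k\<ge>1. slot (even k = e) k" using slots_alternate by blast
  then interpret slotted_path "\<lambda>d n. coord d (f n)" "\<lambda>d n. coord d (P (f n))" R e
    by unfold_locales blast
  interpret weighted_path "\<lambda>d n. coord d (f n)" "\<lambda>d n. coord d (P (f n))" R e \<alpha> \<beta> S D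
  proof
    show "\<alpha> * \<bar>coord d (P (f (Suc k))) - coord d (P (f k))\<bar> +
        \<beta> * \<bar>coord (\<not> d) (P (f (Suc k))) - coord (\<not> d) (P (f k))\<bar> \<le> S" for d k
      using fE[of k] E by (auto simp: abs_minus_commute)
    have "\<not> full (t + 9)"
      if "\<not> D \<le> 2 - R" "t \<ge> 1" "full t" "full (t + 3)" "full (t + 6)" for t
    proof (rule orthogonal_short_gaps)
      show "\<bar>coord True (f (Suc k)) - coord True (f k)\<bar> + \<bar>coord False (f (Suc k)) - coord False (f k)\<bar> = 1" for k
        using fE[of k] short that(1) by (auto simp: coord_def abs_minus_commute)
    qed (use that in auto)
    then show "D \<le> 2 - R \<or> (\<forall>t\<ge>1. full t \<longrightarrow> full (t + 3) \<longrightarrow> full (t + 6) \<longrightarrow> \<not> full (t + 9))" by blast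
  qed (use weights S D in auto)
  show False by (rule no_weighted_path)
qed

section \<open>Linear step bounds from the norms\<close>

lemma pnorm_ereal:
  "pnorm (ereal p) Q = (\<bar>fst Q\<bar> powr p + \<bar>snd Q\<bar> powr p) powr (1 / p)"
  by (simp add: pnorm_def)

lemma pnorm_infinity: "pnorm \<infinity> Q = max \<bar>fst Q\<bar> \<bar>snd Q\<bar>"
  by (simp add: pnorm_def)

lemma ereal_exponent_cases:
  assumes "1 \<le> p"
  obtains (infinity) "p = \<infinity>" | (real) r where "p = ereal r" "1 \<le> r"
  using assms by (cases p) auto

lemma pnorm_ereal_le_iff:
  assumes "1 \<le> p" "0 \<le> R"
  shows "pnorm (ereal p) Q \<le> R \<longleftrightarrow> \<bar>fst Q\<bar> powr p + \<bar>snd Q\<bar> powr p \<le> R powr p"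
proof -
  let ?s = "\<bar>fst Q\<bar> powr p + \<bar>snd Q\<bar> powr p"
  have "(?s powr (1 / p)) powr p = ?s" using assms by (simp add: powr_powr)
  moreover have "?s powr (1 / p) \<le> R \<longleftrightarrow> (?s powr (1 / p)) powr p \<le> R powr p"
    using assms by (meson not_le powr_less_mono2 powr_mono2 powr_ge_zero less_le_trans zero_less_one order.strict_implies_order)
  ultimately show ?thesis by (simp add: pnorm_ereal)
qed

lemma abs_le_pnorm:
  assumes "1 \<le> p"
  shows "\<bar>fst Q\<bar> \<le> pnorm p Q \<and> \<bar>snd Q\<bar> \<le> pnorm p Q"
  using assms
proof (cases rule: ereal_exponent_cases)
  case (real r)
  have "0 \<le> pnorm p Q" by (simp add: real pnorm_ereal)
  then have le: "\<bar>fst Q\<bar> powr r + \<bar>snd Q\<bar> powr r \<le> pnorm p Q powr r"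
    using pnorm_ereal_le_iff[of r "pnorm p Q" Q] real by simp
  have "x \<le> pnorm p Q" if "x powr r \<le> pnorm p Q powr r" "0 \<le> x" for x
    using that \<open>0 \<le> pnorm p Q\<close> powr_less_mono2[of r "pnorm p Q" x] real(2) by linarith
  then show ?thesis
    using le by (smt (verit) powr_ge_zero abs_ge_zero)
qed (simp add: pnorm_infinity)

lemma pnorm_abs: "pnorm p Q = pnorm p (\<bar>fst Q\<bar>, \<bar>snd Q\<bar>)"
  by (simp add: pnorm_def)

lemma pnorm_axis:
  assumes "1 \<le> p"
  shows "pnorm p (x, 0) = \<bar>x\<bar>" "pnorm p (0, x) = \<bar>x\<bar>"
  using assms by (cases rule: ereal_exponent_cases; simp add: pnorm_infinity pnorm_ereal powr_powr)+

lemma powr_ge_tangent: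
  fixes a p v :: real
  assumes "1 \<le> p" "0 < a" "0 \<le> v"
  shows "a powr p + p * a powr (p - 1) * (v - a) \<le> v powr p"
proof -
  \<comment> \<open>Bernoulli's inequality: two uses of \<open>1 + x \<le> exp x\<close> are added
    with a factor \<open>p - 1\<close> so that the logarithms cancel.\<close>
  have "p * t - (p - 1) \<le> t powr p" if "t > 0" for t
  proof -
    have "t * (1 - ln t) \<le> t * exp (- ln t)"
      using exp_ge_add_one_self[of "- ln t"] that by (intro mult_left_mono) auto
    then have 1: "t * (1 - ln t) \<le> 1" using that by (simp add: exp_minus)
    have "t * (1 + (p - 1) * ln t) \<le> t * exp ((p - 1) * ln t)"
      using exp_ge_add_one_self[of "(p - 1) * ln t"] that by (intro mult_left_mono) auto
    also have "\<dots> = t powr p" using that by (simp add: powr_def left_diff_distrib exp_diff)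
    finally have "t * (1 + (p - 1) * ln t) \<le> t powr p" .
    moreover have "(p - 1) * (t * (1 - ln t)) \<le> (p - 1) * 1" using 1 assms(1) by (intro mult_left_mono) auto
    ultimately show ?thesis by (simp add: algebra_simps)
  qed
  then have "p * t - (p - 1) \<le> t powr p" if "t \<ge> 0" for t
    using that assms(1) by (cases "t = 0") auto
  from this[of "v / a"] have "p * (v / a) - (p - 1) \<le> (v / a) powr p" using assms by simp
  then have "a powr p * (p * (v / a) - (p - 1)) \<le> a powr p * (v / a) powr p"
    by (intro mult_left_mono) auto
  also have "\<dots> = v powr p" using assms by (simp flip: powr_mult)
  finally show ?thesis using assms by (simp add: powr_diff field_simps)
qed

text \<open>
  The weights are the slopes of \<open>t\<^sup>p\<close> at the critical step \<open>((2 - R) / 4, D / 4)\<close>. The choice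
  \<open>D = 2 - R\<close> serves the complete neighbour model, \<open>D = 3 - 3R\<close> the nearest neighbour model.
\<close>

lemma finite_component0_ereal:
  fixes p R D :: real
  assumes p: "1 \<le> p" and P: "P \<in> point_collections" and R: "0 < R" "R < 1 / 2"
    and crit: "R powr p < ((2 - R) / 4) powr p + (D / 4) powr p"
    and D: "2 - R \<le> D" "D \<le> 3 - 3 * R"
    and E: "E \<subseteq> edges_CN (ereal p) R P"
    and short: "D \<le> 2 - R \<or> E \<subseteq> {(u, v). \<bar>fst u - fst v\<bar> + \<bar>snd u - snd v\<bar> = 1}"
  shows "finite (component0 E)"
proof -
  define a b where "a = (2 - R) / 4" and "b = D / 4"
  have ab: "0 < a" "a \<le> b" using R D by (auto simp: a_def b_def)
  define \<alpha> \<beta> where "\<alpha> = a powr (p - 1)" and "\<beta> = b powr (p - 1)"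
  \<comment> \<open>\<open>S\<close> is the bound on \<open>\<alpha> * x + \<beta> * y\<close>
    obtained by adding the tangent inequalities at \<open>a\<close> and \<open>b\<close>;
    \<open>crit\<close> puts it below \<open>\<alpha> * a + \<beta> * b\<close>.\<close>
  define S where "S = \<alpha> * a + \<beta> * b - (a powr p + b powr p - R powr p) / p"
  have weights: "0 < \<alpha>" "\<alpha> \<le> \<beta>" using ab p by (auto simp: \<alpha>_def \<beta>_def intro!: powr_mono2)
  have S_bound: "\<alpha> * x + \<beta> * y \<le> S"
    if "x powr p + y powr p \<le> R powr p" "0 \<le> x" "0 \<le> y" for x y
  proof -
    have "a powr p + p * \<alpha> * (x - a) \<le> x powr p" "b powr p + p * \<beta> * (y - b) \<le> y powr p"
      unfolding \<alpha>_def \<beta>_def using p ab that by (auto intro!: powr_ge_tangent)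
    with that(1) have "p * (\<alpha> * (x - a) + \<beta> * (y - b)) \<le> R powr p - a powr p - b powr p"
      by (simp add: algebra_simps)
    then have "\<alpha> * (x - a) + \<beta> * (y - b) \<le> (R powr p - a powr p - b powr p) / p"
      using p by (simp add: pos_le_divide_eq mult.commute)
    then show ?thesis by (simp add: S_def algebra_simps diff_divide_distrib add_divide_distrib)
  qed
  have edge: "E \<subseteq> {(u, v). \<forall>d. \<bar>coord d (P u) - coord d (P v)\<bar> \<le> R \<and>
        \<alpha> * \<bar>coord d (P u) - coord d (P v)\<bar> + \<beta> * \<bar>coord (\<not> d) (P u) - coord (\<not> d) (P v)\<bar> \<le> S}"
  proof (clarify, intro conjI)
    fix u1 u2 v1 v2 :: int and d
    let ?u = "(u1, u2)" and ?v = "(v1, v2)"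
    assume "(?u, ?v) \<in> E"
    then have le: "pnorm (ereal p) (P ?u - P ?v) \<le> R" using E by (auto simp: edges_CN_def)
    then show "\<bar>coord d (P ?u) - coord d (P ?v)\<bar> \<le> R"
      using abs_le_pnorm[of "ereal p" "P ?u - P ?v"] p by (cases d) (auto simp: coord_def)
    have "\<bar>fst (P ?u) - fst (P ?v)\<bar> powr p + \<bar>snd (P ?u) - snd (P ?v)\<bar> powr p \<le> R powr p"
      using le pnorm_ereal_le_iff[of p R "P ?u - P ?v"] p R by simp
    then show "\<alpha> * \<bar>coord d (P ?u) - coord d (P ?v)\<bar> + \<beta> * \<bar>coord (\<not> d) (P ?u) - coord (\<not> d) (P ?v)\<bar> \<le> S"
      by (intro S_bound) (cases d; simp add: coord_def add.commute)+
  qed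
  have "S < (\<alpha> * (2 - R) + \<beta> * D) / 4"
    using crit p by (simp add: S_def a_def b_def add_divide_distrib)
  then show ?thesis
    using finite_component0[OF P R(2) edge weights _ D short] by blast
qed

lemma finite_component0_infinity:
  fixes R D :: real
  assumes P: "P \<in> point_collections" and R: "0 < R" "R < 1 / 2" and crit: "4 * R < D"
    and D: "2 - R \<le> D" "D \<le> 3 - 3 * R"
    and E: "E \<subseteq> edges_CN \<infinity> R P"
    and short: "D \<le> 2 - R \<or> E \<subseteq> {(u, v). \<bar>fst u - fst v\<bar> + \<bar>snd u - snd v\<bar> = 1}"
  shows "finite (component0 E)"
proof -
  \<comment> \<open>The long direction alone gives the contradiction \<open>4 * R < D\<close>; a
    small weight \<open>\<epsilon>\<close> on the short one keeps it strict, and the cap 1 ensures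
    \<open>\<alpha> \<le> \<beta>\<close>.\<close>
  define \<epsilon> where "\<epsilon> = min 1 ((D - 4 * R) / 4)"
  have \<epsilon>: "0 < \<epsilon>" "\<epsilon> \<le> 1" "4 * \<epsilon> \<le> D - 4 * R" using crit by (auto simp: \<epsilon>_def min_def)
  have edge: "E \<subseteq> {(u, v). \<forall>d. \<bar>coord d (P u) - coord d (P v)\<bar> \<le> R \<and>
        \<epsilon> * \<bar>coord d (P u) - coord d (P v)\<bar> + 1 * \<bar>coord (\<not> d) (P u) - coord (\<not> d) (P v)\<bar> \<le> (\<epsilon> + 1) * R}"
  proof (clarify, intro conjI)
    fix u1 u2 v1 v2 :: int and d
    let ?u = "(u1, u2)" and ?v = "(v1, v2)"
    assume "(?u, ?v) \<in> E"
    then have le: "pnorm \<infinity> (P ?u - P ?v) \<le> R" using E by (auto simp: edges_CN_def)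
    then have le: "\<bar>coord d (P ?u) - coord d (P ?v)\<bar> \<le> R" for d
      by (cases d) (auto simp: coord_def pnorm_infinity)
    then show "\<bar>coord d (P ?u) - coord d (P ?v)\<bar> \<le> R" .
    show "\<epsilon> * \<bar>coord d (P ?u) - coord d (P ?v)\<bar> + 1 * \<bar>coord (\<not> d) (P ?u) - coord (\<not> d) (P ?v)\<bar> \<le> (\<epsilon> + 1) * R"
    proof -
      have "\<epsilon> * \<bar>coord d (P ?u) - coord d (P ?v)\<bar> \<le> \<epsilon> * R"
        using le[of d] \<epsilon>(1) by (intro mult_left_mono) auto
      then show ?thesis using le[of "\<not> d"] by (simp add: distrib_right)
    qed
  qed
  define z where "z = \<epsilon> * R"
  have "z < \<epsilon>" using mult_strict_left_mono[of R 1 \<epsilon>] \<epsilon>(1) R by (simp add: z_def)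
  then have "z + R < (2 * \<epsilon> - z + D) / 4" using \<epsilon> by simp
  then have "(\<epsilon> + 1) * R < (\<epsilon> * (2 - R) + 1 * D) / 4" by (simp add: z_def algebra_simps)
  then show ?thesis
    using finite_component0[OF P R(2) edge \<epsilon>(1,2) _ D short] by blast
qed

section \<open>Infinite components\<close>

lemma edges_NN_subset: "edges_NN p R P \<subseteq> edges_CN p R P"
  by (simp add: edges_NN_def)

lemma edges_NN_iff:
  "(u, v) \<in> edges_NN p R P \<longleftrightarrow> (u, v) \<in> edges_CN p R P \<and> \<bar>fst u - fst v\<bar> + \<bar>snd u - snd v\<bar> = 1"
proof -
  have "pnorm 1 (map_prod real_of_int real_of_int (u - v)) = real_of_int (\<bar>fst u - fst v\<bar> + \<bar>snd u - snd v\<bar>)"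
    using pnorm_ereal[of 1] by (simp add: one_ereal_def)
  then have "pnorm 1 (map_prod real_of_int real_of_int (u - v)) = 1 \<longleftrightarrow> \<bar>fst u - fst v\<bar> + \<bar>snd u - snd v\<bar> = 1"
    by (metis of_int_1 of_int_eq_iff)
  then show ?thesis by (simp add: edges_NN_def)
qed

lemma edge_CN_I:
  assumes "(u::int \<times> int) \<noteq> v" "\<bar>fst (P u) - fst (P v)\<bar> = a" "\<bar>snd (P u) - snd (P v)\<bar> = b" "pnorm p (a, b) \<le> R"
  shows "(u, v) \<in> edges_CN p R P"
  using assms pnorm_abs[of p "P u - P v"] by (simp add: edges_CN_def)

text \<open>Consecutive values need only be joined by a path, so \<open>f\<close> can list one cell
  per period.\<close>

lemma infinite_component0I:
  assumes inj: "inj (f :: nat \<Rightarrow> int \<times> int)" and f: "f 0 = (0, 0)" "\<And>n. (f n, f (Suc n)) \<in> E\<^sup>*"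
  shows "infinite (component0 E)"
proof -
  have "((0, 0), f n) \<in> E\<^sup>*" for n
  proof (induction n)
    case (Suc n)
    then show ?case using f(2)[of n] by (rule rtrancl_trans)
  qed (simp add: f)
  then have "range f \<subseteq> component0 E" by (auto simp: component0_def)
  then show ?thesis using inj finite_subset range_inj_infinite by blast
qed

lemma component0_mono: "E \<subseteq> F \<Longrightarrow> component0 E \<subseteq> component0 F"
  using rtrancl_mono by (auto simp: component0_def)

text \<open>The points of rows 0 and 1 lie at height 1 with spacing 1/2, in the order
  \<open>(i, 0)\<close>, \<open>(i, 1)\<close>, \<open>(i + 1, 1)\<close>, \<open>(i + 1, 0)\<close>
  for even \<open>i\<close>.\<close>

definition strip :: "int \<times> int \<Rightarrow> real \<times> real" where
  "strip = (\<lambda>(i, j).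
     (real_of_int i + (if j \<in> {0, 1} \<and> (even i \<longleftrightarrow> j = 1) then 1 / 2 else 0), real_of_int j + (if j = 0 then 1 else 0)))"

lemma strip_infinite:
  assumes "1 \<le> p"
  shows "strip \<in> point_collections" "infinite (component0 (edges_NN p (1 / 2) strip))"
proof -
  show "strip \<in> point_collections" by (auto simp: point_collections_def strip_def)
  let ?E = "edges_NN p (1 / 2) strip"
  have horizontal: "pnorm p (1 / 2, 0) \<le> 1 / 2" using pnorm_axis(1)[OF assms, of "1 / 2"] by simp
  have E: "((i, 0), (i, 1)) \<in> ?E" "((i, 1), (i, 0)) \<in> ?E"
    "even i \<Longrightarrow> ((i, 1), (i + 1, 1)) \<in> ?E" "odd i \<Longrightarrow> ((i, 0), (i + 1, 0)) \<in> ?E" for i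
    unfolding edges_NN_iff
    by (auto intro!: edge_CN_I[OF _ _ _ horizontal] simp: strip_def)
  have "((i, 0), (i + 1, 0)) \<in> ?E\<^sup>*" for i
  proof (cases "even i")
    case True
    then show ?thesis
      using E(1)[of i] E(3)[of i] E(2)[of "i + 1"] by (meson converse_rtrancl_into_rtrancl r_into_rtrancl)
  qed (use E(4) in blast)
  from this[of "int n" for n] have "((int n, 0), (int (Suc n), 0)) \<in> ?E\<^sup>*" for n
    by (simp add: add.commute)
  then show "infinite (component0 ?E)"
    by (intro infinite_component0I[where f = "\<lambda>n. (int n, 0)"]) (auto simp: inj_def)
qed

text \<open>The points of \<open>(i, i + 1)\<close> and \<open>(i + 1, i)\<close> lie
  \<open>R / 2\<close> to either side of the common corner \<open>(i + 1, i + 1)\<close>,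
  horizontally for even \<open>i\<close> and vertically for odd \<open>i\<close>. The diagonal cells
  are placed so that all other steps have both components \<open>(2 - R) / 4\<close>.\<close>

definition diagonal :: "real \<Rightarrow> int \<times> int \<Rightarrow> real \<times> real" where
  "diagonal R = (\<lambda>(i, j). (real_of_int i, real_of_int j) +
     (if j = i then (if even i then (1 / 2 - R / 4, 1 / 2 + R / 4) else (1 / 2 + R / 4, 1 / 2 - R / 4))
      else if j = i + 1 then (if even i then (1 - R / 2, 0) else (1, R / 2))
      else if j = i - 1 then (if even i then (0, 1 - R / 2) else (R / 2, 1))
      else (0, 0)))"

lemma diagonal_infinite:
  assumes p: "1 \<le> p" and R: "0 < R" "R \<le> 1" and norm: "pnorm p ((2 - R) / 4, (2 - R) / 4) \<le> R"
  shows "diagonal R \<in> point_collections" "infinite (component0 (edges_CN p R (diagonal R)))"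
proof -
  show "diagonal R \<in> point_collections" using R by (auto simp: point_collections_def diagonal_def)
  let ?E = "edges_CN p R (diagonal R)"
  have axis: "pnorm p (R, 0) \<le> R" "pnorm p (0, R) \<le> R" using pnorm_axis[OF p, of R] R by auto
  have "((i, i), (i + 2, i + 2)) \<in> ?E\<^sup>*" if "even i" for i
  proof -
    have "((i, i), (i, i + 1)) \<in> ?E" "((i + 1, i), (i + 1, i + 1)) \<in> ?E"
      "((i + 1, i + 1), (i + 2, i + 1)) \<in> ?E" "((i + 1, i + 2), (i + 2, i + 2)) \<in> ?E"
      using that R by (auto intro!: edge_CN_I[OF _ _ _ norm] simp: diagonal_def field_simps)
    moreover have "((i, i + 1), (i + 1, i)) \<in> ?E"
      using that R by (auto intro!: edge_CN_I[OF _ _ _ axis(1)] simp: diagonal_def field_simps)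
    moreover have "((i + 2, i + 1), (i + 1, i + 2)) \<in> ?E"
      using that R by (auto intro!: edge_CN_I[OF _ _ _ axis(2)] simp: diagonal_def field_simps)
    ultimately show ?thesis by (meson converse_rtrancl_into_rtrancl r_into_rtrancl)
  qed
  from this[of "2 * int n" for n]
  have "((2 * int n, 2 * int n), (2 * int (Suc n), 2 * int (Suc n))) \<in> ?E\<^sup>*" for n
    by (simp add: algebra_simps)
  then show "infinite (component0 ?E)"
    by (intro infinite_component0I[where f = "\<lambda>n. (2 * int n, 2 * int n)"]) (auto simp: inj_def)
qed

text \<open>
  One period visits the cells (0,0), (1,0), (1,1), (2,1), (2,0), (3,0), (3,-1), (2,-1), (2,-2), (3,-2),
  (3,-3), (4,-3), (4,-2), (5,-2), (5,-1), (4,-1), (4,0). A step of size \<open>R\<close> along one axis is taken while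
  the other coordinate rests on an integer line; all other steps are
  \<open>(\<plusminus>(2 - R) / 4, \<plusminus>(3 - 3R) / 4)\<close>.
\<close>

definition meander :: "real \<Rightarrow> int \<times> int \<Rightarrow> real \<times> real" where
  "meander R = (\<lambda>(i, j). (real_of_int i, real_of_int j) +
     (if i mod 4 = 0 then
        (if j = 0 then (1, 3 * R / 2 - 1 / 2) else if j = -1 then (1, 1 / 2 + R / 2)
         else if j = -2 then (1 / 2 + R / 4, 3 / 4 - 3 * R / 4) else if j = -3 then (R / 2, 1) else (0, 0))
      else if i mod 4 = 1 then
        (if j = 1 then (1 - R / 2, 0) else if j = 0 then (1 / 2 - R / 4, 1 / 4 + 3 * R / 4)
         else if j = -1 then (0, 1 / 2 - R / 2) else if j = -2 then (0, 3 / 2 - 3 * R / 2) else (0, 0))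
      else if i mod 4 = 2 then
        (if j = 1 then (R / 2, 0) else if j = 0 then (1 / 2 + R / 4, 1 / 4 + 3 * R / 4)
         else if j = -1 then (1, 1 / 2 - R / 2) else if j = -2 then (1, 3 / 2 - 3 * R / 2) else (0, 0))
      else
        (if j = 0 then (0, 3 * R / 2 - 1 / 2) else if j = -1 then (0, 1 / 2 + R / 2)
         else if j = -2 then (1 / 2 - R / 4, 3 / 4 - 3 * R / 4) else if j = -3 then (1 - R / 2, 1) else (0, 0))))"

lemma meander_infinite:
  assumes p: "1 \<le> p" and R: "1 / 3 \<le> R" "R \<le> 1" and norm: "pnorm p ((2 - R) / 4, (3 - 3 * R) / 4) \<le> R"
  shows "meander R \<in> point_collections" "infinite (component0 (edges_NN p R (meander R)))"
proof -
  \<comment> \<open>The bound \<open>1 / 3 \<le> R\<close> keeps the offsets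
    \<open>3 * R / 2 - 1 / 2\<close> and \<open>3 / 2 - 3 * R / 2\<close> in the unit
    interval.\<close>
  show "meander R \<in> point_collections" using R by (auto simp: point_collections_def meander_def)
  let ?E = "edges_NN p R (meander R)"
  have axis: "pnorm p (R, 0) \<le> R" "pnorm p (0, R) \<le> R" using pnorm_axis[OF p, of R] R by auto
  have path: "((i, 0), (i + 4, 0)) \<in> ?E\<^sup>*" if "i mod 4 = 0" for i
  proof -
    have mod: "(i + 1) mod 4 = 1" "(i + 2) mod 4 = 2" "(i + 3) mod 4 = 3" "(i + 4) mod 4 = 0" "(i + 5) mod 4 = 1"
      using that by presburger+
    note diagonal_step = edge_CN_I[OF _ _ _ norm]
    have "((i, 0), (i + 1, 0)) \<in> ?E" "((i + 1, 0), (i + 1, 1)) \<in> ?E"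
      "((i + 2, 1), (i + 2, 0)) \<in> ?E" "((i + 2, 0), (i + 3, 0)) \<in> ?E"
      "((i + 2, -2), (i + 3, -2)) \<in> ?E" "((i + 3, -2), (i + 3, -3)) \<in> ?E"
      "((i + 4, -3), (i + 4, -2)) \<in> ?E" "((i + 4, -2), (i + 5, -2)) \<in> ?E"
      using R that mod unfolding edges_NN_iff
      by (auto intro!: diagonal_step simp: meander_def field_simps)
    moreover have "((i + 1, 1), (i + 2, 1)) \<in> ?E" "((i + 3, -3), (i + 4, -3)) \<in> ?E"
      using R that mod unfolding edges_NN_iff
      by (auto intro!: edge_CN_I[OF _ _ _ axis(1)] simp: meander_def field_simps)
    moreover have "((i + 3, 0), (i + 3, -1)) \<in> ?E" "((i + 3, -1), (i + 2, -1)) \<in> ?E" "((i + 2, -1), (i + 2, -2)) \<in> ?E"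
      "((i + 5, -2), (i + 5, -1)) \<in> ?E" "((i + 5, -1), (i + 4, -1)) \<in> ?E" "((i + 4, -1), (i + 4, 0)) \<in> ?E"
      using R that mod unfolding edges_NN_iff
      by (auto intro!: edge_CN_I[OF _ _ _ axis(2)] simp: meander_def field_simps)
    ultimately show ?thesis by (meson converse_rtrancl_into_rtrancl r_into_rtrancl)
  qed
  have "((4 * int n, 0), (4 * int (Suc n), 0)) \<in> ?E\<^sup>*" for n
    using path[of "4 * int n"] by (simp add: algebra_simps)
  then show "infinite (component0 ?E)"
    by (intro infinite_component0I[where f = "\<lambda>n. (4 * int n, 0)"]) (auto simp: inj_def)
qed

section \<open>The connectivity radii\<close>

lemma critical_gap_strict_antimono:
  fixes p :: real
  assumes "1 \<le> p" "0 \<le> x" "x < y" "y \<le> 1"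
  shows "(2 - y) powr p + (3 - 3 * y) powr p - (4 * y) powr p < (2 - x) powr p + (3 - 3 * x) powr p - (4 * x) powr p"
proof -
  have "(2 - y) powr p < (2 - x) powr p" "(3 - 3 * y) powr p < (3 - 3 * x) powr p" "(4 * x) powr p < (4 * y) powr p"
    using assms by (auto intro!: powr_less_mono2)
  then show ?thesis by linarith
qed

lemma critical_root_exists:
  fixes p :: real
  assumes p: "1 \<le> p"
  shows "\<exists>!R. is_critical_root p R"
proof -
  let ?f = "\<lambda>R::real. (2 - R) powr p + (3 - 3 * R) powr p - (4 * R) powr p"
  have "continuous_on {0..1} ?f"
    using p by (intro continuous_intros continuous_on_powr') auto
  moreover have "?f 1 \<le> 0" "0 \<le> ?f 0"
    using p powr_mono2[of p 1 4] by auto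
  ultimately obtain R where R: "0 \<le> R" "R \<le> 1" "?f R = 0"
    using IVT2'[of ?f 1 0 0] by auto
  show ?thesis
  proof (rule ex1I)
    show "is_critical_root p R" using R by (simp add: is_critical_root_def)
    show "R' = R" if "is_critical_root p R'" for R'
      using that R critical_gap_strict_antimono[OF p, of R R'] critical_gap_strict_antimono[OF p, of R' R]
      unfolding is_critical_root_def atLeastAtMost_iff by (metis eq_iff_diff_eq_0 linorder_neqE_linordered_idom order_less_irrefl)
  qed
qed

text \<open>The explicit collections attain each critical radius, so the infimum is a
  minimum.\<close>

lemma Rmin_CN_eqI:
  assumes "0 < R0" "P \<in> point_collections" "infinite (component0 (edges_CN p R0 P))"
    and "\<And>R P. 0 < R \<Longrightarrow> R < R0 \<Longrightarrow> P \<in> point_collections \<Longrightarrow> finite (component0 (edges_CN p R P))"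
  shows "Rmin_CN p = R0"
  unfolding Rmin_CN_def using assms by (intro cInf_eq_minimum) (blast, force intro: leI)

lemma Rmin_NN_eqI:
  assumes "0 < R0" "P \<in> point_collections" "infinite (component0 (edges_NN p R0 P))"
    and "\<And>R P. 0 < R \<Longrightarrow> R < R0 \<Longrightarrow> P \<in> point_collections \<Longrightarrow> finite (component0 (edges_NN p R P))"
  shows "Rmin_NN p = R0"
  unfolding Rmin_NN_def using assms by (intro cInf_eq_minimum) (blast, force intro: leI)

lemma orthogonal_edges_NN: "edges_NN p R P \<subseteq> {(u, v). \<bar>fst u - fst v\<bar> + \<bar>snd u - snd v\<bar> = 1}"
  by (auto simp: edges_NN_iff)

lemma strip_infinite_CN:
  assumes "1 \<le> p"
  shows "infinite (component0 (edges_CN p (1 / 2) strip))"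
  using strip_infinite(2)[OF assms] by (meson component0_mono edges_NN_subset finite_subset)

lemma Rmin_CN_ereal:
  fixes p :: real
  assumes p: "1 \<le> p"
  shows "Rmin_CN (ereal p) = min (1 / 2) (2 / (1 + 2 powr (2 - 1 / p)))"
proof -
  \<comment> \<open>\<open>t\<close> is the p-norm of (1, 1), so \<open>R1\<close> solves the
    balance equation \<open>R = t * (2 - R) / 4\<close>.\<close>
  define t where "t = (2::real) powr (1 / p)"
  define R1 where "R1 = 2 / (1 + 2 powr (2 - 1 / p))"
  have t: "t > 0" "t powr p = 2" using p by (simp_all add: t_def powr_powr)
  have R1: "R1 = 2 * t / (t + 4)"
    using t by (simp add: R1_def t_def powr_diff field_simps)
  then have pos: "0 < R1" using t by simp
  have R1_eq: "R1 = t * ((2 - R1) / 4)"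
    using t unfolding R1 by (simp add: field_simps)
  have "Rmin_CN (ereal p) = min (1 / 2) R1"
  proof (rule Rmin_CN_eqI)
    let ?P = "if R1 \<le> 1 / 2 then diagonal R1 else strip"
    have norm: "pnorm (ereal p) ((2 - R1) / 4, (2 - R1) / 4) \<le> R1" if "R1 \<le> 1 / 2"
    proof -
      have "2 * ((2 - R1) / 4) powr p = R1 powr p"
        using that t by (subst (2) R1_eq, subst powr_mult) auto
      then show ?thesis
        using that pos p by (subst pnorm_ereal_le_iff) auto
    qed
    show "?P \<in> point_collections"
      using strip_infinite(1)[of "ereal p"] diagonal_infinite(1)[OF _ pos _ norm] p by auto
    show "infinite (component0 (edges_CN (ereal p) (min (1 / 2) R1) ?P))"
      using strip_infinite_CN[of "ereal p"] diagonal_infinite(2)[OF _ pos _ norm] p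
      by (cases "R1 \<le> 1 / 2") (simp_all add: min_absorb1 min_absorb2)
    show "finite (component0 (edges_CN (ereal p) R P))"
      if "0 < R" "R < min (1 / 2) R1" "P \<in> point_collections" for R P
    proof (rule finite_component0_ereal[OF p that(3), where D = "2 - R"])
      have "t * ((2 - R1) / 4) < t * ((2 - R) / 4)" using that t by simp
      then have "R < t * ((2 - R) / 4)" using that R1_eq by simp
      then have "R powr p < (t * ((2 - R) / 4)) powr p" using that p by (intro powr_less_mono2) auto
      also have "\<dots> = 2 * ((2 - R) / 4) powr p" using t that by (subst powr_mult) auto
      finally show "R powr p < ((2 - R) / 4) powr p + ((2 - R) / 4) powr p" by simp
    qed (use that in auto)
  qed (use pos in auto)
  then show ?thesis by (simp add: R1_def)
qed

text \<open>In the maximum norm the critical step gives \<open>4 * R = 2 - R\<close>.\<close>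

lemma Rmin_CN_infinity: "Rmin_CN \<infinity> = 2 / 5"
proof (rule Rmin_CN_eqI)
  have norm: "pnorm \<infinity> ((2 - 2 / 5) / 4, (2 - 2 / 5) / 4) \<le> 2 / 5" by (simp add: pnorm_infinity)
  show "diagonal (2 / 5) \<in> point_collections" "infinite (component0 (edges_CN \<infinity> (2 / 5) (diagonal (2 / 5))))"
    using diagonal_infinite[OF _ _ _ norm] by auto
  show "finite (component0 (edges_CN \<infinity> R P))" if "0 < R" "R < 2 / 5" "P \<in> point_collections" for R P
    by (rule finite_component0_infinity[OF that(3), where D = "2 - R"]) (use that in auto)
qed auto

lemma Rmin_NN_ereal:
  fixes p :: real
  assumes p: "1 \<le> p"
  shows "Rmin_NN (ereal p) = min (1 / 2) (critical_root p)"
proof -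
  define R1 where "R1 = critical_root p"
  have "is_critical_root p R1"
    unfolding R1_def critical_root_def by (rule theI'[OF critical_root_exists[OF p]])
  then have R1: "0 \<le> R1" "R1 \<le> 1" "(2 - R1) powr p + (3 - 3 * R1) powr p = (4 * R1) powr p"
    by (auto simp: is_critical_root_def)
  \<comment> \<open>Dropping one summand of the critical equation yields
    \<open>3 / 7 \<le> R1\<close>, more than the 1/3 that \<open>meander\<close> requires.\<close>
  have "(3 - 3 * R1) powr p \<le> (4 * R1) powr p" using R1(3) powr_ge_zero[of "2 - R1" p] by linarith
  then have "3 - 3 * R1 \<le> 4 * R1"
    using powr_less_mono2[of p "4 * R1" "3 - 3 * R1"] p R1 by linarith
  then have third: "1 / 3 \<le> R1" by simp
  have quarter: "(x / 4) powr p = x powr p / 4 powr p" if "0 \<le> x" for x :: real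
    using that by (simp add: powr_divide)
  have "Rmin_NN (ereal p) = min (1 / 2) R1"
  proof (rule Rmin_NN_eqI)
    let ?P = "if R1 \<le> 1 / 2 then meander R1 else strip"
    have "((2 - R1) / 4) powr p + ((3 - 3 * R1) / 4) powr p = R1 powr p"
      using R1 quarter[of "2 - R1"] quarter[of "3 - 3 * R1"] quarter[of "4 * R1"]
      by (simp flip: add_divide_distrib)
    then have norm: "pnorm (ereal p) ((2 - R1) / 4, (3 - 3 * R1) / 4) \<le> R1"
      using R1 p by (subst pnorm_ereal_le_iff) auto
    show "?P \<in> point_collections"
      using strip_infinite(1)[of "ereal p"] meander_infinite(1)[OF _ third _ norm] p by auto
    show "infinite (component0 (edges_NN (ereal p) (min (1 / 2) R1) ?P))"
      using strip_infinite(2)[of "ereal p"] meander_infinite(2)[OF _ third _ norm] p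
      by (cases "R1 \<le> 1 / 2") (simp_all add: min_absorb1 min_absorb2)
    show "finite (component0 (edges_NN (ereal p) R P))"
      if "0 < R" "R < min (1 / 2) R1" "P \<in> point_collections" for R P
    proof (rule finite_component0_ereal[OF p that(3), where D = "3 - 3 * R"])
      have "(4 * R) powr p < (2 - R) powr p + (3 - 3 * R) powr p"
        using critical_gap_strict_antimono[OF p, of R R1] that R1 by simp
      then have "(4 * R) powr p / 4 powr p < ((2 - R) powr p + (3 - 3 * R) powr p) / 4 powr p"
        by (intro divide_strict_right_mono) auto
      then show "R powr p < ((2 - R) / 4) powr p + ((3 - 3 * R) / 4) powr p"
        using that quarter[of "2 - R"] quarter[of "3 - 3 * R"] quarter[of "4 * R"]
        by (simp add: add_divide_distrib)
    qed (use that edges_NN_subset orthogonal_edges_NN in auto)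
  qed (use third in auto)
  then show ?thesis by (simp add: R1_def)
qed

text \<open>The larger component \<open>(3 - 3 * R) / 4\<close> of the critical step decides, giving
  \<open>4 * R = 3 - 3 * R\<close>.\<close>

lemma Rmin_NN_infinity: "Rmin_NN \<infinity> = 3 / 7"
proof (rule Rmin_NN_eqI)
  have norm: "pnorm \<infinity> ((2 - 3 / 7) / 4, (3 - 3 * (3 / 7)) / 4) \<le> 3 / 7" by (simp add: pnorm_infinity)
  show "meander (3 / 7) \<in> point_collections" "infinite (component0 (edges_NN \<infinity> (3 / 7) (meander (3 / 7))))"
    using meander_infinite[OF _ _ _ norm] by auto
  show "finite (component0 (edges_NN \<infinity> R P))" if "0 < R" "R < 3 / 7" "P \<in> point_collections" for R P
    by (rule finite_component0_infinity[OF that(3), where D = "3 - 3 * R"])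
      (use that edges_NN_subset orthogonal_edges_NN in auto)
qed auto

theorem theorem5:
  shows "((\<forall>p::real. 1 \<le> p \<longrightarrow>
             Rmin_CN (ereal p) = min (1 / 2) (2 / (1 + 2 powr (2 - 1 / p)))) \<and>
          Rmin_CN \<infinity> = 2 / 5) \<and>
         ((\<forall>p::real. 1 \<le> p \<longrightarrow>
             (\<exists>!R. is_critical_root p R) \<and>
             Rmin_NN (ereal p) = min (1 / 2) (critical_root p)) \<and>
          Rmin_NN \<infinity> = 3 / 7)"
  using Rmin_CN_ereal Rmin_CN_infinity critical_root_exists Rmin_NN_ereal Rmin_NN_infinity by blast

end
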